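(* Let $X$ be a term of $T_\Sigma$, let $\tilde x$ be a finite set (or tuple) of names, and let $\sigma$ be a well-sorted substitution. If $\tilde x\#\sigma$ and $(\mathrm n(X)\setminus\tilde x),X\Vdash\tilde x$, then $(\mathrm n(X\sigma)\setminus\tilde x),X\sigma\Vdash\tilde x$.
   Context: $\mathcal N$ is a countably infinite set of names. $T_\Sigma$ is the set of terms generated from the names by the nullary symbol $()$, the binary symbols pairing $(\cdot,\cdot)$, $\mathtt{enc}(\cdot,\cdot)$ and $\mathtt{enc}^{-1}(\cdot,\cdot)$, and the unary symbols $\mathtt{eKey}(\cdot)$ and $\mathtt{dKey}(\cdot)$. $\mathrm n(X)$ is the set of names occurring in $X$. A term has sort $\mathtt{impl}$ iff it has no subterm of the form $\mathtt{enc}^{-1}(N_1,N_2)$; in particular names have sort $\mathtt{impl}$. A well-sorted substitution $\sigma=[\tilde y:=\tilde L]$ consists of a finite tuple $\tilde y$ of distinct names and an equally long tuple $\tilde L$ of terms of sort $\mathtt{impl}$. $\tilde x\#\sigma$ means that no name in $\tilde x$ is in $\tilde y$ or occurs in $\tilde L$. Its action on terms is: $x\sigma=L_i$ if $x=y_i$, and $x\sigma=x$ if $x\notin\tilde y$; $\mathtt{enc}^{-1}(M_1,M_2)\sigma=\mathtt{enc}(M_1\sigma,\mathtt{eKey}(N))$ if $M_2\sigma=\mathtt{dKey}(N)$ for some $N$; and $f(M_1,\dots,M_n)\sigma=f(M_1\sigma,\dots,M_n\sigma)$ in all other cases. Dolev–Yao derivability $\tilde M\Vdash\tilde N$, between finite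 sequences of terms regarded up to reordering (finite sets of names are regarded as such sequences), is the smallest relation closed under: - True: $\tilde M\Vdash{}$ (empty right-hand side). - Id: $\tilde M,N\Vdash\tilde L$ implies $\tilde M,N\Vdash N,\tilde L$. - Copy: $\tilde M\Vdash N,\tilde L$ implies $\tilde M\Vdash N,N,\tilde L$. - Nil: $\tilde M\Vdash\tilde L$ implies $\tilde M\Vdash(),\tilde L$. - Pair: $\tilde M\Vdash N,N',\tilde L$ implies $\tilde M\Vdash(N,N'),\tilde L$. - Split: $\tilde M,N,N'\Vdash\tilde L$ implies $\tilde M,(N,N')\Vdash\tilde L$. - Key: $\tilde M\Vdash N,\tilde L$ implies $\tilde M\Vdash f(N),\tilde L$ for $f\in\{\mathtt{eKey},\mathtt{dKey}\}$. - Encrypt: $\tilde M\Vdash N,N',\tilde L$ implies $\tilde M\Vdash\mathtt{enc}(N,N'),\tilde L$. - Decrypt: $\tilde M\Vdash N'$ and $\tilde M,N\Vdash\tilde L$ imply $\tilde M,\mathtt{enc}^{-1}(N,N')\Vdash\tilde L$. - Unencrypt: $\tilde M\Vdash\mathtt{dKey}(N')$ and $\tilde M,N\Vdash\tilde L$ imply $\tilde M,\mathtt{enc}(N,\mathtt{eKey}(N'))\Vdash\tilde L$. *)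

theory Defs
  imports "HOL-Library.Multiset" "HOL-Library.Countable" "HOL-Library.Infinite_Typeclass"
begin

text \<open>The type parameter \<open>'n\<close> is the type of names; the set function \<open>names\<close> that comes with the
  datatype is \<open>n(X)\<close>. \<open>EncInv\<close> is the symbol \<open>enc\<^sup>-\<^sup>1\<close>, a constructor: terms are not taken
  modulo any equations.\<close>

datatype (names: 'n) trm =
    Name 'n
  | Emp
  | Tup "'n trm" "'n trm"
  | Enc "'n trm" "'n trm"
  | EncInv "'n trm" "'n trm"
  | EKey "'n trm"
  | DKey "'n trm"

lemma finite_names [simp]: "finite (names X)"
  by (induction X) auto

primrec subterms :: "'n trm \<Rightarrow> 'n trm set" where
  "subterms (Name a) = {Name a}"
| "subterms Emp = {Emp}"
| "subterms (Tup M N) = insert (Tup M N) (subterms M \<union> subterms N)"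
| "subterms (Enc M N) = insert (Enc M N) (subterms M \<union> subterms N)"
| "subterms (EncInv M N) = insert (EncInv M N) (subterms M \<union> subterms N)"
| "subterms (EKey M) = insert (EKey M) (subterms M)"
| "subterms (DKey M) = insert (DKey M) (subterms M)"

definition impl :: "'n trm \<Rightarrow> bool" where
  "impl M \<longleftrightarrow> (\<forall>N\<^sub>1 N\<^sub>2. EncInv N\<^sub>1 N\<^sub>2 \<notin> subterms M)"

text \<open>A substitution \<open>[y\<^sub>1, \<dots>, y\<^sub>k := L\<^sub>1, \<dots>, L\<^sub>k]\<close> is the list of the pairs \<open>(y\<^sub>i, L\<^sub>i)\<close>.\<close>

type_synonym 'n subst = "('n \<times> 'n trm) list"

definition well_sorted :: "'n subst \<Rightarrow> bool" where
  "well_sorted \<sigma> \<longleftrightarrow> distinct (map fst \<sigma>) \<and> (\<forall>L \<in> set (map snd \<sigma>). impl L)"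

definition fresh_subst :: "'n list \<Rightarrow> 'n subst \<Rightarrow> bool" where
  "fresh_subst xs \<sigma> \<longleftrightarrow>
     (\<forall>x \<in> set xs. x \<notin> set (map fst \<sigma>) \<and> (\<forall>L \<in> set (map snd \<sigma>). x \<notin> names L))"

primrec subst :: "'n trm \<Rightarrow> 'n subst \<Rightarrow> 'n trm" where
  "subst (Name x) \<sigma> = (case map_of \<sigma> x of Some L \<Rightarrow> L | None \<Rightarrow> Name x)"
| "subst Emp \<sigma> = Emp"
| "subst (Tup M\<^sub>1 M\<^sub>2) \<sigma> = Tup (subst M\<^sub>1 \<sigma>) (subst M\<^sub>2 \<sigma>)"
| "subst (Enc M\<^sub>1 M\<^sub>2) \<sigma> = Enc (subst M\<^sub>1 \<sigma>) (subst M\<^sub>2 \<sigma>)"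
| "subst (EncInv M\<^sub>1 M\<^sub>2) \<sigma> =
     (case subst M\<^sub>2 \<sigma> of
        DKey N \<Rightarrow> Enc (subst M\<^sub>1 \<sigma>) (EKey N)
      | _ \<Rightarrow> EncInv (subst M\<^sub>1 \<sigma>) (subst M\<^sub>2 \<sigma>))"
| "subst (EKey M) \<sigma> = EKey (subst M \<sigma>)"
| "subst (DKey M) \<sigma> = DKey (subst M \<sigma>)"

text \<open>Finite sequences up to reordering are multisets.\<close>

inductive derives :: "'n trm multiset \<Rightarrow> 'n trm multiset \<Rightarrow> bool" (infix "\<tturnstile>" 50) where
  dy_True: "M \<tturnstile> {#}"
| dy_Id: "add_mset N M \<tturnstile> L \<Longrightarrow> add_mset N M \<tturnstile> add_mset N L"
| dy_Copy: "M \<tturnstile> add_mset N L \<Longrightarrow> M \<tturnstile> add_mset N (add_mset N L)"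
| dy_Nil: "M \<tturnstile> L \<Longrightarrow> M \<tturnstile> add_mset Emp L"
| dy_Pair: "M \<tturnstile> add_mset N (add_mset N' L) \<Longrightarrow> M \<tturnstile> add_mset (Tup N N') L"
| dy_Split: "add_mset N (add_mset N' M) \<tturnstile> L \<Longrightarrow> add_mset (Tup N N') M \<tturnstile> L"
| dy_EKey: "M \<tturnstile> add_mset N L \<Longrightarrow> M \<tturnstile> add_mset (EKey N) L"
| dy_DKey: "M \<tturnstile> add_mset N L \<Longrightarrow> M \<tturnstile> add_mset (DKey N) L"
| dy_Encrypt: "M \<tturnstile> add_mset N (add_mset N' L) \<Longrightarrow> M \<tturnstile> add_mset (Enc N N') L"
| dy_Decrypt: "M \<tturnstile> {#N'#} \<Longrightarrow> add_mset N M \<tturnstile> L \<Longrightarrow> add_mset (EncInv N N') M \<tturnstile> L"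
| dy_Unencrypt:
    "M \<tturnstile> {#DKey N'#} \<Longrightarrow> add_mset N M \<tturnstile> L \<Longrightarrow> add_mset (Enc N (EKey N')) M \<tturnstile> L"

definition name_set :: "'n set \<Rightarrow> 'n trm multiset" where
  "name_set A = image_mset Name (mset_set A)"

definition name_tuple :: "'n list \<Rightarrow> 'n trm multiset" where
  "name_tuple xs = image_mset Name (mset xs)"

end

theory Submission imports Defs begin

text \<open>Derivations are closed under every substitution: a Decrypt step whose key becomes a
  decryption key turns into an Unencrypt step. Substituting in the given derivation leaves the
  names \<open>xs\<close> on the right unchanged, but it replaces the public names on the left by the terms
  substituted for them. These have sort \<open>impl\<close> and only public names, so they can be built by the
  constructor rules, and analysing them reveals only terms of the same kind: they can be cut.\<close>

lemma impl_simps [simp]: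
  "impl (Name a)" "impl Emp"
  "impl (Tup M N) \<longleftrightarrow> impl M \<and> impl N"
  "impl (Enc M N) \<longleftrightarrow> impl M \<and> impl N"
  "\<not> impl (EncInv M N)"
  "impl (EKey M) \<longleftrightarrow> impl M"
  "impl (DKey M) \<longleftrightarrow> impl M"
  by (auto simp: impl_def)

text \<open>The only rewriting that a substitution causes turns \<open>EncInv\<close> with key
  \<open>DKey K\<close> into \<open>Enc\<close> with key \<open>EKey K\<close>; it changes symbols
  but no names.\<close>

lemma names_subst: "names (subst X \<sigma>) = (\<Union>y\<in>names X. names (subst (Name y) \<sigma>))"
proof (induction X)
  case (EncInv M N)
  then show ?case by (auto split: trm.splits)
qed auto

lemma derives_subst:
  assumes "M \<tturnstile> L"
  shows "image_mset (\<lambda>N. subst N \<sigma>) M \<tturnstile> image_mset (\<lambda>N. subst N \<sigma>) L"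
  using assms
proof (induction rule: derives.induct)
  case (dy_Decrypt M N' N L)
  \<comment> \<open>If the key becomes \<open>DKey K\<close>, the first induction hypothesis derives
    exactly the key that Unencrypt asks for.\<close>
  then show ?case
    by (cases "subst N' \<sigma>") (auto intro: derives.intros)
qed (auto intro: derives.intros)

lemma derives_weaken: "M \<tturnstile> L \<Longrightarrow> M + K \<tturnstile> L"
  by (induction rule: derives.induct) (auto intro: derives.intros)

text \<open>Names come from \<open>G\<close> by Id, and every other symbol allowed in sort
  \<open>impl\<close> has a rule building it on the right. Generalising over \<open>L\<close> lets
  the two arguments of a binary symbol be built one after the other.\<close>

lemma derives_impl:
  assumes "impl N" "Name ` names N \<subseteq> set_mset G" "G \<tturnstile> L"
  shows "G \<tturnstile> add_mset N L"
  using assms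
proof (induction N arbitrary: L)
  case (Name a)
  then obtain G' where "G = add_mset (Name a) G'"
    by (auto dest: multi_member_split)
  with Name show ?case by (auto intro: dy_Id)
qed (auto simp: image_Un intro!: dy_Nil dy_Pair dy_Encrypt dy_EKey dy_DKey)

lemma add_mset_eq_plusE:
  assumes "add_mset N M = G + D"
  obtains G' where "G = add_mset N G'" "M = G' + D"
    | D' where "D = add_mset N D'" "M = G + D'"
proof -
  have "N \<in># G + D" by (metis assms union_single_eq_member)
  then consider "N \<in># G" | "N \<in># D" by auto
  then show thesis
    using assms that by cases (auto dest!: multi_member_split)
qed

text \<open>Induction on the derivation, for all splittings of its left side into a kept part
  \<open>G\<close> and a cut part \<open>D\<close>. Where Id uses a term of \<open>D\<close>, that
  term is built from \<open>G\<close> instead.\<close>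

lemma derives_cut_impl:
  assumes "G + D \<tturnstile> L"
    and "\<And>N. N \<in># D \<Longrightarrow> impl N \<and> Name ` names N \<subseteq> set_mset G"
  shows "G \<tturnstile> L"
  using assms
proof (induction "G + D" L arbitrary: G D rule: derives.induct)
  case (dy_Id N M L)
  then have "G \<tturnstile> L" by blast
  from dy_Id.hyps(3) show ?case
  proof (cases rule: add_mset_eq_plusE)
    case 1
    with \<open>G \<tturnstile> L\<close> show ?thesis by (auto intro: derives.dy_Id)
  next
    case 2
    with \<open>G \<tturnstile> L\<close> dy_Id.prems show ?thesis by (auto intro: derives_impl)
  qed
next
  case (dy_Split N N' M L)
  from dy_Split.hyps(3) show ?case
  proof (cases rule: add_mset_eq_plusE)
    case (1 G')
    \<comment> \<open>\<open>Tup N N'\<close> is not a name, so \<open>G'\<close> still contains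
      every name that the terms in \<open>D\<close> need. The same holds for the two decryption
      rules below.\<close>
    have "add_mset N (add_mset N' G') \<tturnstile> L"
      by (rule dy_Split.hyps(2)[of _ D]) (use 1 dy_Split.prems in fastforce)+
    with 1 show ?thesis by (auto intro: derives.dy_Split)
  next
    case (2 D')
    show ?thesis
      by (rule dy_Split.hyps(2)[of _ "add_mset N (add_mset N' D')"])
        (use 2 dy_Split.prems dy_Split.prems[of "Tup N N'"] in \<open>auto simp: image_Un\<close>)
  qed
next
  case (dy_Decrypt M N' N L)
  from dy_Decrypt.hyps(5) show ?case
  proof (cases rule: add_mset_eq_plusE)
    case (1 G')
    have "G' \<tturnstile> {#N'#}"
      by (rule dy_Decrypt.hyps(2)[of _ D]) (use 1 dy_Decrypt.prems in fastforce)+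
    moreover have "add_mset N G' \<tturnstile> L"
      by (rule dy_Decrypt.hyps(4)[of _ D]) (use 1 dy_Decrypt.prems in fastforce)+
    ultimately show ?thesis using 1 by (auto intro: derives.dy_Decrypt)
  next
    case (2 D')
    with dy_Decrypt.prems[of "EncInv N N'"] show ?thesis by simp
  qed
next
  case (dy_Unencrypt M N' N L)
  from dy_Unencrypt.hyps(5) show ?case
  proof (cases rule: add_mset_eq_plusE)
    case (1 G')
    have "G' \<tturnstile> {#DKey N'#}"
      by (rule dy_Unencrypt.hyps(2)[of _ D]) (use 1 dy_Unencrypt.prems in fastforce)+
    moreover have "add_mset N G' \<tturnstile> L"
      by (rule dy_Unencrypt.hyps(4)[of _ D]) (use 1 dy_Unencrypt.prems in fastforce)+
    ultimately show ?thesis using 1 by (auto intro: derives.dy_Unencrypt)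
  next
    case (2 D')
    \<comment> \<open>The plaintext \<open>N\<close> inherits sort \<open>impl\<close> and its names
      from the ciphertext, so it may join the cut part.\<close>
    show ?thesis
      by (rule dy_Unencrypt.hyps(4)[of _ "add_mset N D'"])
        (use 2 dy_Unencrypt.prems dy_Unencrypt.prems[of "Enc N (EKey N')"] in \<open>auto simp: image_Un\<close>)
  qed
qed (auto intro: derives.intros)

lemma set_mset_name_set: "finite A \<Longrightarrow> set_mset (name_set A) = Name ` A"
  by (simp add: name_set_def)

lemma impl_subst_Name: "well_sorted \<sigma> \<Longrightarrow> impl (subst (Name y) \<sigma>)"
  by (auto simp: well_sorted_def split: option.splits dest!: map_of_SomeD)

lemma fresh_subst_Name:
  assumes "fresh_subst xs \<sigma>" "x \<in> set xs"
  shows "subst (Name x) \<sigma> = Name x"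
    and "x \<in> names (subst (Name y) \<sigma>) \<Longrightarrow> y = x"
  using assms
  by (force simp: fresh_subst_def split: option.splits if_splits dest: map_of_SomeD)+

theorem lemma5p3:
  fixes X :: "'n::{countable,infinite} trm" and xs :: "'n list" and \<sigma> :: "'n subst"
  assumes "well_sorted \<sigma>"
    and "fresh_subst xs \<sigma>"
    and "add_mset X (name_set (names X - set xs)) \<tturnstile> name_tuple xs"
  shows "add_mset (subst X \<sigma>) (name_set (names (subst X \<sigma>) - set xs)) \<tturnstile> name_tuple xs"
proof -
  let ?D = "image_mset (\<lambda>N. subst N \<sigma>) (name_set (names X - set xs))"
  let ?P = "name_set (names (subst X \<sigma>) - set xs)"
  have "image_mset (\<lambda>N. subst N \<sigma>) (name_tuple xs) = name_tuple xs"
    using fresh_subst_Name(1)[OF assms(2)]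
    by (auto simp: name_tuple_def multiset.map_comp simp del: subst.simps intro!: image_mset_cong)
  with derives_subst[OF assms(3), of \<sigma>]
  have "add_mset (subst X \<sigma>) ?D \<tturnstile> name_tuple xs"
    by simp
  \<comment> \<open>The names in \<open>?P\<close> have to be present before the cut, since the
    terms in \<open>?D\<close> are built from them.\<close>
  from derives_weaken[OF this, of ?P]
  have "add_mset (subst X \<sigma>) ?P + ?D \<tturnstile> name_tuple xs"
    by (simp add: add.commute)
  then show ?thesis
  proof (rule derives_cut_impl)
    fix N assume "N \<in># ?D"
    then obtain y where y: "y \<in> names X" "y \<notin> set xs" "N = subst (Name y) \<sigma>"
      by (auto simp: set_mset_name_set simp del: subst.simps)
    \<comment> \<open>As \<open>y\<close> occurs in \<open>X\<close>, the names of \<open>N\<close>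
      occur in \<open>subst X \<sigma>\<close>; as \<open>y\<close> is not in \<open>xs\<close>,
      freshness keeps the names in \<open>xs\<close> out of \<open>N\<close>.\<close>
    then have "names N \<subseteq> names (subst X \<sigma>) - set xs"
      using fresh_subst_Name(2)[OF assms(2)] by (auto simp: names_subst[of X] simp del: subst.simps)
    with y show "impl N \<and> Name ` names N \<subseteq> set_mset (add_mset (subst X \<sigma>) ?P)"
      using impl_subst_Name[OF assms(1)] by (auto simp: set_mset_name_set simp del: subst.simps)
  qed
qed

end
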